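(* Every connected quartic half-arc-transitive weak metacirculant belongs to at least one of the four classes: Class I, Class II, Class III, Class IV.
   Context: All graphs are finite, simple and undirected. Quartic means regular of valency $4$. A graph $X$ is half-arc-transitive if $\mathrm{Aut}\,X$ is transitive on vertices and on edges but not on arcs. Automorphisms act on the right. For integers $m\ge 1$, $n\ge 2$, an automorphism of a graph is $(m,n)$-semiregular if it has $m$ orbits of length $n$ on vertices and no other orbit. $X$ is a weak $(m,n)$-metacirculant relative to the ordered pair $(\rho,\sigma)$ of automorphisms if $\rho$ is $(m,n)$-semiregular, $\sigma^{-1}\rho\sigma=\rho^r$ for some $r\in\mathbb{Z}_n^*$, and $\sigma$ cyclically permutes the orbits of $\rho$. $X$ is a weak metacirculant if this holds for some $m,n,\rho,\sigma$. Let $X$ be such a graph, and denote the orbits of $\rho$ by $X_i$, $i\in\mathbb{Z}_m$, with $X_{i+1}=X_i\sigma$. The inner degree $d_{inn}(X)$ is the common valency of the induced subgraphs on the orbits $X_i$. Two distinct orbits $X_i,X_j$ are connected with a single (respectively double) edge if every vertex of $X_i$ has exactly one (respectively exactly two) neighbours in $X_j$. A connected quartic half-arc-transitive weak metacirculant $X$ belongs to a given class if the condition below holds for some choice of $m,n,\rho,\sigma$ relative to which $X$ is a weak $(m,n)$-metacirculant: - Class I: $d_{inn}(X)=0$ and each orbit $X_i$ is connected with a double edge to two other orbits. - Class II: $d_{inn}(X)=2$ and each orbit $X_i$ is connected with a single edge to two other orbits. - Class III: $d_{inn}(X)=0$ and each orbit $X_i$ is connected to three other orbits, to one with a double edge and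 to two with a single edge (then $m$ is even and the double edge connects $X_i$ with $X_{i+\frac m2}$). - Class IV: $d_{inn}(X)=0$ and each orbit $X_i$ is connected with a single edge to four other orbits. *)

theory Defs
  imports
    "Graph_Theory.Pair_Digraph"
    "Graph_Theory.Digraph_Component"
    "HOL-Combinatorics.Orbits"
    "HOL-Combinatorics.Permutations"
begin

text \<open>
  A finite simple undirected graph is a \<open>pair_graph\<close>: a finite vertex set with a symmetric,
  irreflexive arc relation. The elements of \<open>parcs\<close> are then exactly the arcs of the graph in
  the sense of algebraic graph theory (ordered pairs of adjacent vertices), and the valency of
  a vertex is its out-degree.
\<close>

definition regular :: "'a pair_pre_digraph \<Rightarrow> nat \<Rightarrow> bool" where
  "regular G d \<longleftrightarrow> (\<forall>v\<in>pverts G. out_degree (with_proj G) v = d)"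

definition quartic :: "'a pair_pre_digraph \<Rightarrow> bool" where
  "quartic G \<longleftrightarrow> regular G 4"

definition uedges :: "'a pair_pre_digraph \<Rightarrow> 'a set set" where
  "uedges G = {{u, v} | u v. (u, v) \<in> parcs G}"


subsection \<open>Automorphisms and half-arc-transitivity\<close>

text \<open>
  Automorphisms are functions on the whole type that fix every point outside the vertex set, so
  that equality of automorphisms is equality of functions.
\<close>

definition Aut :: "'a pair_pre_digraph \<Rightarrow> ('a \<Rightarrow> 'a) set" where
  "Aut G = {f. f permutes pverts G \<and>
     (\<forall>u\<in>pverts G. \<forall>v\<in>pverts G. (f u, f v) \<in> parcs G \<longleftrightarrow> (u, v) \<in> parcs G)}"

definition vertex_transitive :: "'a pair_pre_digraph \<Rightarrow> bool" where
  "vertex_transitive G \<longleftrightarrow> (\<forall>u\<in>pverts G. \<forall>v\<in>pverts G. \<exists>f\<in>Aut G. f u = v)"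

definition edge_transitive :: "'a pair_pre_digraph \<Rightarrow> bool" where
  "edge_transitive G \<longleftrightarrow> (\<forall>e\<in>uedges G. \<forall>e'\<in>uedges G. \<exists>f\<in>Aut G. f ` e = e')"

definition arc_transitive :: "'a pair_pre_digraph \<Rightarrow> bool" where
  "arc_transitive G \<longleftrightarrow> (\<forall>(u, v)\<in>parcs G. \<forall>(x, y)\<in>parcs G. \<exists>f\<in>Aut G. f u = x \<and> f v = y)"

definition half_arc_transitive :: "'a pair_pre_digraph \<Rightarrow> bool" where
  "half_arc_transitive G \<longleftrightarrow> vertex_transitive G \<and> edge_transitive G \<and> \<not> arc_transitive G"


subsection \<open>Weak metacirculants\<close>

definition orbits :: "'a pair_pre_digraph \<Rightarrow> ('a \<Rightarrow> 'a) \<Rightarrow> 'a set set" where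
  "orbits G \<rho> = orbit \<rho> ` pverts G"

definition semiregular :: "'a pair_pre_digraph \<Rightarrow> nat \<Rightarrow> nat \<Rightarrow> ('a \<Rightarrow> 'a) \<Rightarrow> bool" where
  "semiregular G m n \<rho> \<longleftrightarrow>
     \<rho> \<in> Aut G \<and> card (orbits G \<rho>) = m \<and> (\<forall>B\<in>orbits G \<rho>. card B = n)"

text \<open>
  Automorphisms act on the right, so the product \<open>\<sigma>\<^sup>-\<^sup>1\<rho>\<sigma>\<close> applies \<open>\<sigma>\<^sup>-\<^sup>1\<close> first; as a composition
  of functions it is \<open>\<sigma> \<circ> \<rho> \<circ> inv \<sigma>\<close>.
\<close>

definition weak_metacirculant_rel ::
  "'a pair_pre_digraph \<Rightarrow> nat \<Rightarrow> nat \<Rightarrow> ('a \<Rightarrow> 'a) \<Rightarrow> ('a \<Rightarrow> 'a) \<Rightarrow> bool" where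
  "weak_metacirculant_rel G m n \<rho> \<sigma> \<longleftrightarrow>
     m \<ge> 1 \<and> n \<ge> 2 \<and> semiregular G m n \<rho> \<and> \<sigma> \<in> Aut G \<and>
     (\<exists>r::nat. coprime r n \<and> \<sigma> \<circ> \<rho> \<circ> inv \<sigma> = \<rho> ^^ r) \<and>
     cyclic_on (image \<sigma>) (orbits G \<rho>)"

definition weak_metacirculant :: "'a pair_pre_digraph \<Rightarrow> bool" where
  "weak_metacirculant G \<longleftrightarrow> (\<exists>m n \<rho> \<sigma>. weak_metacirculant_rel G m n \<rho> \<sigma>)"


subsection \<open>The four classes\<close>

definition has_inner_degree :: "'a pair_pre_digraph \<Rightarrow> ('a \<Rightarrow> 'a) \<Rightarrow> nat \<Rightarrow> bool" where
  "has_inner_degree G \<rho> d \<longleftrightarrow>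
     (\<forall>B\<in>orbits G \<rho>. \<forall>v\<in>B. out_degree (induce_subgraph (with_proj G) B) v = d)"

definition connected_by :: "'a pair_pre_digraph \<Rightarrow> nat \<Rightarrow> 'a set \<Rightarrow> 'a set \<Rightarrow> bool" where
  "connected_by G k B C \<longleftrightarrow> (\<forall>v\<in>B. card {w \<in> C. (v, w) \<in> parcs G} = k)"

definition single_edge_orbits :: "'a pair_pre_digraph \<Rightarrow> ('a \<Rightarrow> 'a) \<Rightarrow> 'a set \<Rightarrow> 'a set set" where
  "single_edge_orbits G \<rho> B = {C \<in> orbits G \<rho>. C \<noteq> B \<and> connected_by G 1 B C}"

definition double_edge_orbits :: "'a pair_pre_digraph \<Rightarrow> ('a \<Rightarrow> 'a) \<Rightarrow> 'a set \<Rightarrow> 'a set set" where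
  "double_edge_orbits G \<rho> B = {C \<in> orbits G \<rho>. C \<noteq> B \<and> connected_by G 2 B C}"

definition class_I :: "'a pair_pre_digraph \<Rightarrow> bool" where
  "class_I G \<longleftrightarrow> (\<exists>m n \<rho> \<sigma>. weak_metacirculant_rel G m n \<rho> \<sigma> \<and> has_inner_degree G \<rho> 0 \<and>
     (\<forall>B\<in>orbits G \<rho>. card (double_edge_orbits G \<rho> B) = 2))"

definition class_II :: "'a pair_pre_digraph \<Rightarrow> bool" where
  "class_II G \<longleftrightarrow> (\<exists>m n \<rho> \<sigma>. weak_metacirculant_rel G m n \<rho> \<sigma> \<and> has_inner_degree G \<rho> 2 \<and>
     (\<forall>B\<in>orbits G \<rho>. card (single_edge_orbits G \<rho> B) = 2))"

definition class_III :: "'a pair_pre_digraph \<Rightarrow> bool" where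
  "class_III G \<longleftrightarrow> (\<exists>m n \<rho> \<sigma>. weak_metacirculant_rel G m n \<rho> \<sigma> \<and> has_inner_degree G \<rho> 0 \<and>
     (\<forall>B\<in>orbits G \<rho>. card (double_edge_orbits G \<rho> B) = 1 \<and> card (single_edge_orbits G \<rho> B) = 2))"

definition class_IV :: "'a pair_pre_digraph \<Rightarrow> bool" where
  "class_IV G \<longleftrightarrow> (\<exists>m n \<rho> \<sigma>. weak_metacirculant_rel G m n \<rho> \<sigma> \<and> has_inner_degree G \<rho> 0 \<and>
     (\<forall>B\<in>orbits G \<rho>. card (single_edge_orbits G \<rho> B) = 4))"

end

theory Submission
  imports Defs
begin

text \<open>
  The same \<open>m\<close>, \<open>n\<close>, \<open>\<rho>\<close> and \<open>\<sigma>\<close> that witness the metacirculant property also witness the class,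
  and the proof reads the class off from the numbers of edges between the orbits of \<open>\<rho>\<close>.

  Let \<open>w k\<close> be the number of neighbours that a vertex of an orbit \<open>B\<close> has in the orbit \<open>\<sigma>\<^sup>k(B)\<close>. As
  \<open>\<sigma>\<close> is an automorphism that permutes the orbits in one cycle, \<open>w k\<close> is the same for every \<open>B\<close>, so
  the quotient is a weighted circulant on \<open>\<int>\<^sub>m\<close>: the weights add up to 4 and \<open>w (m - k) = w k\<close>.
  Half-arc-transitivity enters through one consequence: no automorphism interchanges the ends of
  an edge (\<open>half_arc_transitive_no_flip\<close>). In particular \<open>x \<mapsto> - x\<close> acts without fixed points on the
  connection set inside an orbit, so \<open>w 0\<close> is even (\<open>even_inner_weight\<close>). The parity of the total
  then makes the weight at \<open>m/2\<close> even as well, and \<open>circulant_weight_cases\<close> lists what is possible: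
  the four classes, or else all the weight lies on \<open>w 0\<close>, or on \<open>w 0\<close> and \<open>w (m/2)\<close>.

  In the latter situations connectedness leaves only one or two orbits, with \<open>w 0 = 4\<close>, with
  weights \<open>2, 2\<close>, or with weights \<open>0, 4\<close>. Writing the orbits as \<open>u\<^sub>i\<close> and \<open>v\<^sub>i\<close> with \<open>\<rho>\<close> adding 1 to the
  index, each of these graphs has an explicit automorphism that flips an edge: \<open>u\<^sub>i \<mapsto> u\<^bsub>a-i\<^esub>\<close> for a
  circulant; the same together with \<open>v\<^sub>i \<mapsto> v\<^bsub>a+s+t-i\<^esub>\<close> when \<open>u\<^sub>0\<close> is joined to just \<open>v\<^sub>s\<close> and \<open>v\<^sub>t\<close>, because
  a two-element set \<open>{s, t}\<close> is invariant under \<open>k \<mapsto> s + t - k\<close>; and \<open>u\<^sub>i \<mapsto> v\<^bsub>s-i\<^esub>\<close>, \<open>v\<^sub>i \<mapsto> u\<^bsub>s-i\<^esub>\<close> in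
  the bipartite case. So none of them is half-arc-transitive.
\<close>

section \<open>Involutions, cycles and symmetric weights\<close>

lemma even_card_involution:
  assumes "finite S" and "\<And>x. x \<in> S \<Longrightarrow> f x \<in> S \<and> f (f x) = x \<and> f x \<noteq> x"
  shows "even (card S)"
proof -
  let ?C = "(\<lambda>x. {x, f x}) ` S"
  have U: "\<Union>?C = S" using assms(2) by auto
  have "2 * card ?C = card (\<Union>?C)"
  proof (rule card_partition)
    show "finite ?C" "finite (\<Union>?C)" using assms(1) U by auto
    show "card c = 2" if "c \<in> ?C" for c
    proof -
      from that obtain x where "x \<in> S" "c = {x, f x}" by auto
      then show ?thesis using assms(2)[of x] by (simp add: card_2_iff) metis
    qed
    show "c \<inter> d = {}" if cd: "c \<in> ?C" "d \<in> ?C" "c \<noteq> d" for c d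
    proof -
      from cd obtain x y where x: "x \<in> S" "c = {x, f x}" and y: "y \<in> S" "d = {y, f y}" by auto
      have "x \<noteq> y" "x \<noteq> f y" using cd(3) x y assms(2)[OF y(1)] by auto
      moreover have "f x \<noteq> y" "f x \<noteq> f y" using calculation assms(2)[OF x(1)] assms(2)[OF y(1)] by metis+
      ultimately show ?thesis using x y by auto
    qed
  qed
  then show ?thesis using U by (metis dvd_triv_left)
qed

lemma orbit_enumeration:
  assumes "x \<in> orbit f x" and "card (orbit f x) = N"
  shows "(f ^^ N) x = x" and "inj_on (\<lambda>k. (f ^^ k) x) {..<N}"
    and "orbit f x = (\<lambda>k. (f ^^ k) x) ` {..<N}" and "0 < N"
proof -
  let ?d = "funpow_dist1 f x x"
  have o: "orbit f x = (\<lambda>k. (f ^^ k) x) ` {0..<?d}"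
    using orbit_conv_funpow_dist1[OF assms(1)] .
  have i: "inj_on (\<lambda>k. (f ^^ k) x) {0..<?d}"
    using inj_on_funpow_dist1[OF assms(1)] .
  have N: "?d = N" using assms(2) o card_image[OF i] by simp
  show "(f ^^ N) x = x" using funpow_dist1_prop[OF assms(1)] N by simp
  show "inj_on (\<lambda>k. (f ^^ k) x) {..<N}" "orbit f x = (\<lambda>k. (f ^^ k) x) ` {..<N}"
    using i o unfolding N by (simp_all add: atLeast0LessThan)
  show "0 < N" using N by simp
qed

text \<open>
  The purely numerical part of the classification. The reflection \<open>k \<mapsto> m - k\<close> pairs the nonzero
  residues except \<open>m/2\<close>. With \<open>P\<close> a set of representatives of the pairs and \<open>S\<close> its weight, the
  equation \<open>w 0 + 2 * S + w (m/2) = 4\<close> holds, where the last term is absent for odd \<open>m\<close>. The case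
  \<open>S = 0\<close> gives the last three outcomes, and \<open>S = 1\<close> or \<open>S = 2\<close> the four classes.
\<close>
lemma circulant_weight_cases:
  fixes w :: "nat \<Rightarrow> nat" and m :: nat
  assumes "1 \<le> m" and sym: "\<forall>k\<in>{0<..<m}. w (m - k) = w k"
    and even: "even (w 0)" and total: "(\<Sum>k<m. w k) = 4"
  defines "c \<equiv> \<lambda>j. card {k. 0 < k \<and> k < m \<and> w k = j}"
  obtains "w 0 = 0" "c 2 = 2" | "w 0 = 2" "c 1 = 2"
    | "w 0 = 0" "c 2 = 1" "c 1 = 2" | "w 0 = 0" "c 1 = 4"
    | "w 0 = 4" | k where "0 < k" "k < m" "w 0 = 2" "w k = 2"
    | k where "0 < k" "k < m" "w 0 = 0" "w k = 4"
proof -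
  \<comment> \<open>\<open>H\<close> is \<open>{m/2}\<close> for even \<open>m\<close> and empty for odd \<open>m\<close>.\<close>
  define P where "P = {k. 0 < k \<and> 2 * k < m}"
  define H where "H = {k. 0 < k \<and> 2 * k = m}"
  define d where "d = (\<lambda>j. card {k \<in> P. w k = j})"
  define S where "S = sum w P"
  let ?r = "\<lambda>k. m - k"
  have fin: "finite P" "finite H" unfolding P_def H_def by (auto intro: finite_subset[of _ "{..m}"])
  have inj: "inj_on ?r A" if "A \<subseteq> P" for A using that by (auto simp: inj_on_def P_def)
  have split: "{..<m} = {0} \<union> (P \<union> ?r ` P \<union> H)"
  proof -
    have "k \<in> ?r ` P" if "k < m" "m < 2 * k" for k
      using that by (intro image_eqI[of _ _ "m - k"]) (auto simp: P_def)
    then show ?thesis using assms(1) unfolding P_def H_def by fastforce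
  qed
  have r: "w (m - k) = w k" if "k \<in> P" for k using that sym by (auto simp: P_def)
  have disj: "P \<inter> ?r ` P = {}" "(P \<union> ?r ` P) \<inter> H = {}" "0 \<notin> P \<union> ?r ` P \<union> H"
    by (auto simp: P_def H_def)
  have "(\<Sum>k<m. w k) = w 0 + (sum w P + sum w (?r ` P) + sum w H)"
    unfolding split using disj fin by (simp add: sum.union_disjoint)
  also have "sum w (?r ` P) = S"
    unfolding S_def using r by (simp add: sum.reindex[OF inj[OF order.refl]])
  finally have sum4: "w 0 + 2 * S + sum w H = 4" using total by (simp add: S_def)
  have c: "c j = 2 * d j + card {k \<in> H. w k = j}" for j
  proof -
    let ?A = "{k \<in> P. w k = j}" and ?B = "{k \<in> H. w k = j}"
    have "{k. 0 < k \<and> k < m \<and> w k = j} = {k \<in> {..<m} - {0}. w k = j}" by auto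
    also have "\<dots> = {k \<in> P \<union> ?r ` P \<union> H. w k = j}" unfolding split using disj(3) by auto
    also have "\<dots> = ?A \<union> ?r ` ?A \<union> ?B" using r by auto
    finally have "c j = card (?A \<union> ?r ` ?A \<union> ?B)" unfolding c_def by simp
    also have "\<dots> = card (?A \<union> ?r ` ?A) + card ?B"
      using disj fin by (intro card_Un_disjoint) auto
    also have "card (?A \<union> ?r ` ?A) = card ?A + card (?r ` ?A)"
      using disj fin by (intro card_Un_disjoint) auto
    also have "card (?r ` ?A) = card ?A" by (intro card_image inj) auto
    finally show ?thesis by (simp add: d_def)
  qed
  have S: "S = d 1 + 2 * d 2"
  proof -
    have "w k \<le> 2" if "k \<in> P" for k
      using member_le_sum[OF that, of w] fin sum4 unfolding S_def by simp
    then have "S = (\<Sum>k\<in>P. (if w k = 1 then 1 else 0) + 2 * (if w k = 2 then 1 else 0))"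
      unfolding S_def by (intro sum.cong) (force simp: le_Suc_eq numeral_2_eq_2)+
    also have "\<dots> = d 1 + 2 * d 2"
      unfolding d_def using fin
      by (simp add: sum.distrib sum_distrib_left[symmetric] sum.If_cases Int_def)
    finally show ?thesis .
  qed
  consider "H = {}" | h where "H = {h}" "0 < h" "h < m"
  proof (cases "H = {}")
    case False
    then obtain h where "h \<in> H" by blast
    then have "H = {h}" "0 < h" "h < m" unfolding H_def by auto
    then show ?thesis using that(2) by blast
  qed (use that in blast)
  then show thesis
  proof cases
    case 1
    then have e: "w 0 + 2 * S = 4" "c 1 = 2 * d 1" "c 2 = 2 * d 2" using sum4 c by simp_all
    have "s = 0 \<or> s = 1 \<and> p = 1 \<or> s = 2 \<and> q = 1 \<or> s = 2 \<and> p = 2"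
      if "x + 2 * s = 4" "s = p + 2 * q" for x s p q :: nat using that by presburger
    from this[OF e(1) S] consider "S = 0" | "S = 1" "d 1 = 1" | "S = 2" "d 2 = 1" | "S = 2" "d 1 = 2" by blast
    then show thesis using e S that by cases auto
  next
    case (2 h)
    have "{k \<in> H. w k = j} = (if w h = j then {h} else {})" for j using 2 by auto
    then have Hj: "card {k \<in> H. w k = j} = (if w h = j then 1 else 0)" for j by simp
    have e: "w 0 + 2 * S + w h = 4" "c 1 = 2 * d 1 + (if w h = 1 then 1 else 0)"
      "c 2 = 2 * d 2 + (if w h = 2 then 1 else 0)"
      using sum4 2(1) c[of 1] c[of 2] unfolding Hj by simp_all
    obtain a where a: "w 0 = 2 * a" using even by blast
    have "even (w 0 + 2 * S + w h)" unfolding e(1) by simp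
    then obtain b where b: "w h = 2 * b" using a by auto
    have "a + (d 1 + 2 * d 2) + b = 2" using e a b S by simp
    moreover have "a = 2 \<or> a = 1 \<and> b = 1 \<or> a = 0 \<and> b = 2 \<or> a = 1 \<and> b = 0 \<and> p = 1 \<or>
      a = 0 \<and> b = 1 \<and> p = 1 \<and> q = 0 \<or> a = 0 \<and> b = 0 \<and> p = 0 \<and> q = 1 \<or>
      a = 0 \<and> b = 0 \<and> p = 2 \<and> q = 0" if "a + (p + 2 * q) + b = 2" for a b p q :: nat
      using that by presburger
    ultimately have "a = 2 \<or> a = 1 \<and> b = 1 \<or> a = 0 \<and> b = 2 \<or> a = 1 \<and> b = 0 \<and> d 1 = 1 \<or>
      a = 0 \<and> b = 1 \<and> d 1 = 1 \<and> d 2 = 0 \<or> a = 0 \<and> b = 0 \<and> d 1 = 0 \<and> d 2 = 1 \<or>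
      a = 0 \<and> b = 0 \<and> d 1 = 2 \<and> d 2 = 0" by blast
    then consider "a = 2" | "a = 1" "b = 1" | "a = 0" "b = 2" | "a = 1" "b = 0" "d 1 = 1"
      | "a = 0" "b = 1" "d 1 = 1" "d 2 = 0" | "a = 0" "b = 0" "d 1 = 0" "d 2 = 1"
      | "a = 0" "b = 0" "d 1 = 2" "d 2 = 0" by (elim disjE conjE) blast+
   
    then show thesis using e S a b 2 that by cases auto
  qed
qed

section \<open>Automorphisms\<close>

context pair_graph
begin

lemma Aut_adj_iff:
  assumes "f \<in> Aut G"
  shows "(f x, f y) \<in> parcs G \<longleftrightarrow> (x, y) \<in> parcs G"
proof -
  have "f permutes pverts G" using assms by (simp add: Aut_def)
  then have "f z \<in> pverts G \<longleftrightarrow> z \<in> pverts G" for z by (simp add: permutes_in_image)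
  then show ?thesis using assms in_arcsD1 in_arcsD2 unfolding Aut_def by blast
qed

lemma Aut_comp: "f \<in> Aut G \<Longrightarrow> g \<in> Aut G \<Longrightarrow> f \<circ> g \<in> Aut G"
  using Aut_adj_iff by (simp add: Aut_def permutes_compose)

lemma Aut_funpow: "f \<in> Aut G \<Longrightarrow> f ^^ k \<in> Aut G"
proof (induction k)
  case 0
  then show ?case by (simp add: Aut_def permutes_id id_def[symmetric])
qed (simp add: Aut_comp)

lemma involution_in_Aut:
  assumes "\<And>x. x \<in> pverts G \<Longrightarrow> h x \<in> pverts G \<and> h (h x) = x"
    and "\<And>x. x \<notin> pverts G \<Longrightarrow> h x = x"
    and adj: "\<And>x y. (x, y) \<in> parcs G \<Longrightarrow> (h x, h y) \<in> parcs G"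
  shows "h \<in> Aut G"
proof -
  have hh: "h (h x) = x" for x using assms(1,2) by (cases "x \<in> pverts G") auto
  then have "bij h" by (metis bijI')
  then have "h permutes pverts G" using assms(2) by (simp add: permutes_def) (metis bij_pointE)
  then show ?thesis using adj hh unfolding Aut_def by (auto; metis)
qed

text \<open>
  Any two edges are related by some automorphism, possibly with the wrong orientation; composing
  with an edge flip on the way corrects the orientation, so the graph would be arc-transitive.
\<close>
lemma half_arc_transitive_no_flip:
  assumes hat: "half_arc_transitive G" and h: "h \<in> Aut G"
    and xy: "(x, y) \<in> parcs G" "h x = y" "h y = x"
  shows False
proof -
  have et: "edge_transitive G" using hat by (simp add: half_arc_transitive_def)
  have "\<exists>f\<in>Aut G. f a = c \<and> f b = d" if "(a, b) \<in> parcs G" "(c, d) \<in> parcs G" for a b c d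
  proof -
    have "{a, b} \<in> uedges G" "{c, d} \<in> uedges G" "{x, y} \<in> uedges G"
      using that xy unfolding uedges_def by blast+
    then obtain f g where f: "f \<in> Aut G" "f ` {a, b} = {x, y}" and g: "g \<in> Aut G" "g ` {x, y} = {c, d}"
      using et unfolding edge_transitive_def by meson
    have ne: "a \<noteq> b" "c \<noteq> d" "x \<noteq> y" using that xy no_loops' by blast+
    have "f a = x \<and> f b = y \<or> f a = y \<and> f b = x" using f(2) ne by (auto simp: doubleton_eq_iff)
    moreover have "g x = c \<and> g y = d \<or> g x = d \<and> g y = c"
      using g(2) ne by (auto simp: doubleton_eq_iff)
    ultimately have "(g \<circ> f) a = c \<and> (g \<circ> f) b = d \<or> (g \<circ> (h \<circ> f)) a = c \<and> (g \<circ> (h \<circ> f)) b = d"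
      using xy by auto
    moreover have "g \<circ> f \<in> Aut G" "g \<circ> (h \<circ> f) \<in> Aut G" using f g h Aut_comp by blast+
    ultimately show ?thesis by blast
  qed
  then have "arc_transitive G" unfolding arc_transitive_def by blast
  then show False using hat by (simp add: half_arc_transitive_def)
qed

lemma out_degree_eq_card: "out_degree (with_proj G) v = card {w \<in> pverts G. (v, w) \<in> parcs G}"
proof -
  have "out_arcs (with_proj G) v = Pair v ` {w \<in> pverts G. (v, w) \<in> parcs G}"
    using in_arcsD2 by (auto simp: out_arcs_def)
  then show ?thesis unfolding out_degree_def by (simp add: card_image inj_on_def)
qed

lemma out_degree_induced:
  assumes "v \<in> B"
  shows "out_degree (induce_subgraph (with_proj G) B) v = card {w \<in> B. (v, w) \<in> parcs G}"
proof -
  have "out_arcs (induce_subgraph (with_proj G) B) v = Pair v ` {w \<in> B. (v, w) \<in> parcs G}"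
    using assms by (auto simp: out_arcs_def induce_subgraph_def)
  then show ?thesis unfolding out_degree_def by (simp add: card_image inj_on_def)
qed

lemma connected_closed_set:
  assumes conn: "Digraph_Component.connected (with_proj G)"
    and "S \<subseteq> pverts G" "S \<noteq> {}" and closed: "\<And>x y. x \<in> S \<Longrightarrow> (x, y) \<in> parcs G \<Longrightarrow> y \<in> S"
  shows "S = pverts G"
proof -
  let ?H = "with_proj (mk_symmetric (with_proj G))"
  have arcs: "parcs (mk_symmetric (with_proj G)) = parcs G"
    using arcs_symmetric by (force simp: mk_symmetric_def)
  obtain x where x: "x \<in> S" using assms by blast
  have "y \<in> S" if y: "y \<in> pverts G" for y
  proof -
    have "x \<rightarrow>\<^sup>*\<^bsub>?H\<^esub> y"
      using conn x y assms(2)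
      by (auto simp: Digraph_Component.connected_def strongly_connected_def mk_symmetric_def)
    then show ?thesis unfolding reachable_def with_proj_simps arcs
      by (induction rule: rtrancl_on_induct) (auto intro: x closed)
  qed
  then show ?thesis using assms(2) by blast
qed

end

section \<open>The cyclic group generated by a semiregular automorphism\<close>

locale semiregular_graph = pair_graph G for G :: "'a pair_pre_digraph" +
  fixes \<rho> :: "'a \<Rightarrow> 'a" and m n :: nat
  assumes semi: "semiregular G m n \<rho>" and n_pos: "0 < n"
begin

lemma rho_Aut: "\<rho> \<in> Aut G" and rho_permutes: "\<rho> permutes pverts G"
  using semi by (auto simp: semiregular_def Aut_def)

lemma self_in_orbit: "x \<in> orbit \<rho> x"
  using rho_permutes pair_finite_verts permutation_self_in_orbit permutation_permutes by metis

lemma card_orbit: "x \<in> pverts G \<Longrightarrow> card (orbit \<rho> x) = n"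
  using semi by (auto simp: semiregular_def orbits_def)

lemma rho_pow_n: "(\<rho> ^^ n) x = x"
proof (cases "x \<in> pverts G")
  case True
  then show ?thesis using orbit_enumeration(1)[OF self_in_orbit] card_orbit by blast
next
  case False
  then have "\<rho> x = x" using rho_permutes by (simp add: permutes_not_in)
  then show ?thesis by (induction n) simp_all
qed

text \<open>
  Integer powers of \<open>\<rho>\<close>, so that \<open>rot (- i)\<close> is the inverse of \<open>rot i\<close> and \<open>rot i u\<close> can be read as
  the vertex \<open>u\<^sub>i\<close> of the orbit of \<open>u\<close>.
\<close>
definition rot :: "int \<Rightarrow> 'a \<Rightarrow> 'a" where
  "rot i = \<rho> ^^ nat (i mod int n)"

lemma rot_of_nat: "rot (int k) x = (\<rho> ^^ k) x"
  using funpow_mod_eq[OF rho_pow_n, of k x] by (simp add: rot_def flip: of_nat_mod)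

lemma rot_rot [simp]: "rot i (rot j x) = rot (i + j) x"
proof -
  have "rot i (rot j x) = (\<rho> ^^ (nat (i mod int n) + nat (j mod int n))) x"
    by (simp add: rot_def funpow_add)
  also have "\<dots> = rot (i mod int n + j mod int n) x"
    using n_pos by (simp flip: rot_of_nat)
  also have "\<dots> = rot (i + j) x" by (simp add: rot_def mod_simps)
  finally show ?thesis .
qed

lemma rot_0 [simp]: "rot 0 x = x"
  by (simp add: rot_def)

lemma rot_Aut: "rot i \<in> Aut G"
  unfolding rot_def using rho_Aut by (rule Aut_funpow)

lemma rot_adj_iff [simp]: "(rot i x, rot i y) \<in> parcs G \<longleftrightarrow> (x, y) \<in> parcs G"
  using rot_Aut by (rule Aut_adj_iff)

lemma rot_in_verts_iff [simp]: "rot i x \<in> pverts G \<longleftrightarrow> x \<in> pverts G"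
  using rot_Aut[of i] by (simp add: Aut_def permutes_in_image)

lemma orbit_eq_range_rot: "orbit \<rho> x = range (\<lambda>i. rot i x)"
proof -
  have "orbit \<rho> x = {(\<rho> ^^ k) x |k. True}"
    using orbit_altdef_self_in[OF self_in_orbit] .
  also have "\<dots> = range (\<lambda>i. rot i x)"
  proof (intro equalityI subsetI)
    show "y \<in> range (\<lambda>i. rot i x)" if "y \<in> {(\<rho> ^^ k) x |k. True}" for y
      using that by (auto simp flip: rot_of_nat)
    show "y \<in> {(\<rho> ^^ k) x |k. True}" if "y \<in> range (\<lambda>i. rot i x)" for y
      using that by (auto simp: rot_def)
  qed
  finally show ?thesis .
qed

lemma rot_eq_iff:
  assumes "x \<in> pverts G"
  shows "rot i x = rot j x \<longleftrightarrow> i mod int n = j mod int n"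
proof
  assume "rot i x = rot j x"
  moreover have "nat (k mod int n) < n" for k using n_pos by (simp add: nat_less_iff)
  ultimately have "nat (i mod int n) = nat (j mod int n)"
    using orbit_enumeration(2)[OF self_in_orbit card_orbit[OF assms]]
    unfolding rot_def by (auto dest: inj_onD)
  then show "i mod int n = j mod int n" using n_pos by (simp add: nat_eq_iff)
qed (simp add: rot_def)

text \<open>
  By semiregularity the index of a vertex is determined modulo \<open>n\<close> whatever the base point, which
  makes the reflections below well defined even between different orbits.
\<close>
lemma rot_eq_transfer:
  assumes "u \<in> pverts G" "v \<in> pverts G" "rot i u = rot j u"
  shows "rot (c - i) v = rot (c - j) v"
  using assms mod_diff_cong[OF refl, of i "int n" j c] by (simp add: rot_eq_iff)

text \<open>
  The map \<open>u\<^sub>i \<mapsto> v\<^bsub>c-i\<^esub>\<close> from the orbit of \<open>u\<close> to the orbit of \<open>v\<close>.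
\<close>
definition reflect :: "'a \<Rightarrow> 'a \<Rightarrow> int \<Rightarrow> 'a \<Rightarrow> 'a" where
  "reflect u v c x = rot (c - (SOME i. rot i u = x)) v"

lemma reflect_rot:
  assumes "u \<in> pverts G" "v \<in> pverts G"
  shows "reflect u v c (rot i u) = rot (c - i) v"
proof -
  have "rot (SOME j. rot j u = rot i u) u = rot i u" by (rule someI) simp
  then show ?thesis unfolding reflect_def using rot_eq_transfer assms by blast
qed

lemma orbit_base:
  assumes "B \<in> orbits G \<rho>" "u \<in> B"
  shows "B = range (\<lambda>i. rot i u)" and "u \<in> pverts G"
proof -
  obtain b where b: "b \<in> pverts G" "B = range (\<lambda>i. rot i b)"
    using assms(1) unfolding orbits_def orbit_eq_range_rot by blast
  then obtain k where k: "u = rot k b" using assms(2) by blast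
  show "u \<in> pverts G" using b k by simp
  have "rot i b = rot (i - k) u" "rot i u = rot (i + k) b" for i using k by simp_all
  then show "B = range (\<lambda>i. rot i u)" unfolding b(2) by blast
qed

lemma orbit_nonemptyE:
  assumes "B \<in> orbits G \<rho>"
  obtains u where "u \<in> B"
  using assms self_in_orbit by (auto simp: orbits_def)

lemma orbit_subset_verts: "B \<in> orbits G \<rho> \<Longrightarrow> B \<subseteq> pverts G"
  using orbit_base(2) by blast

lemma finite_orbit_set: "B \<in> orbits G \<rho> \<Longrightarrow> finite B"
  using orbit_subset_verts pair_finite_verts finite_subset by blast

lemma rot_in_orbit_iff: "B \<in> orbits G \<rho> \<Longrightarrow> rot i x \<in> B \<longleftrightarrow> x \<in> B"
proof -
  assume B: "B \<in> orbits G \<rho>"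
  have "rot j y \<in> B" if "y \<in> B" for j y using orbit_base(1)[OF B that] by auto
  from this[of x i] this[of "rot i x" "- i"] show ?thesis by auto
qed

lemma orbits_disjoint:
  assumes "B \<in> orbits G \<rho>" "C \<in> orbits G \<rho>" "B \<noteq> C"
  shows "B \<inter> C = {}"
  using assms orbit_base(1) by blast

lemma Union_orbits: "\<Union>(orbits G \<rho>) = pverts G"
  using orbit_subset_verts self_in_orbit by (auto simp: orbits_def)

section \<open>Numbers of edges between orbits\<close>

text \<open>
  The choice of a vertex of \<open>B\<close> is immaterial when \<open>B\<close> and \<open>C\<close> are orbits, because \<open>\<rho>\<close> is transitive on
  \<open>B\<close> and preserves \<open>C\<close>.
\<close>
definition edge_weight :: "'a set \<Rightarrow> 'a set \<Rightarrow> nat" where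
  "edge_weight B C = card {w \<in> C. (SOME v. v \<in> B, w) \<in> parcs G}"

lemma card_neighbours_rot:
  assumes "C \<in> orbits G \<rho>"
  shows "card {w \<in> C. (rot i v, w) \<in> parcs G} = card {w \<in> C. (v, w) \<in> parcs G}"
proof -
  have "bij_betw (rot i) {w \<in> C. (v, w) \<in> parcs G} {w \<in> C. (rot i v, w) \<in> parcs G}"
  proof (rule bij_betw_byWitness[where f' = "rot (- i)"])
    show "rot (- i) ` {w \<in> C. (rot i v, w) \<in> parcs G} \<subseteq> {w \<in> C. (v, w) \<in> parcs G}"
      using rot_in_orbit_iff[OF assms] rot_adj_iff[of "- i" "rot i v"] by auto
  qed (use rot_in_orbit_iff[OF assms] in auto)
  then show ?thesis by (simp add: bij_betw_same_card)
qed

lemma edge_weight: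
  assumes "B \<in> orbits G \<rho>" "C \<in> orbits G \<rho>" "v \<in> B"
  shows "card {w \<in> C. (v, w) \<in> parcs G} = edge_weight B C"
proof -
  have "(SOME v. v \<in> B) \<in> B" using assms(3) by (rule someI)
  then obtain i where "(SOME v. v \<in> B) = rot i v" using orbit_base(1)[OF assms(1,3)] by blast
  then show ?thesis unfolding edge_weight_def using card_neighbours_rot[OF assms(2)] by simp
qed

text \<open>
  Double counting of the edges between \<open>B\<close> and \<open>C\<close>, which have equal size by semiregularity.
\<close>
lemma edge_weight_sym:
  assumes "B \<in> orbits G \<rho>" "C \<in> orbits G \<rho>"
  shows "edge_weight B C = edge_weight C B"
proof -
  have fin: "finite B" "finite C" using assms finite_orbit_set by auto
  have n: "card B = n" "card C = n" using assms semi by (auto simp: semiregular_def)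
  have "(\<Sum>v\<in>B. card {w \<in> C. (v, w) \<in> parcs G}) = (\<Sum>w\<in>C. card {v \<in> B. (v, w) \<in> parcs G})"
    using sum_multicount_gen[OF fin(2) fin(1), of "\<lambda>w v. (v, w) \<in> parcs G" "\<lambda>v. card {w \<in> C. (v, w) \<in> parcs G}"]
    by (simp add: fin)
  also have "\<dots> = (\<Sum>w\<in>C. card {v \<in> B. (w, v) \<in> parcs G})"
    using arcs_symmetric by (intro sum.cong arg_cong[of _ _ card]) auto
  finally have "n * edge_weight B C = n * edge_weight C B"
    using assms n edge_weight by simp
  then show ?thesis using n_pos by simp
qed

lemma sum_edge_weight:
  assumes "B \<in> orbits G \<rho>" "regular G d"
  shows "(\<Sum>C\<in>orbits G \<rho>. edge_weight B C) = d"
proof -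
  obtain v where v: "v \<in> B" using assms orbit_nonemptyE by blast
  then have vG: "v \<in> pverts G" using orbit_subset_verts assms by blast
  have "(\<Sum>C\<in>orbits G \<rho>. edge_weight B C) = (\<Sum>C\<in>orbits G \<rho>. card {w \<in> C. (v, w) \<in> parcs G})"
    using edge_weight assms v by simp
  also have "\<dots> = card (\<Union>C\<in>orbits G \<rho>. {w \<in> C. (v, w) \<in> parcs G})"
  proof (rule card_UN_disjoint[symmetric])
    show "finite (orbits G \<rho>)" using pair_finite_verts by (simp add: orbits_def)
  qed (use finite_orbit_set orbits_disjoint in auto)
  also have "(\<Union>C\<in>orbits G \<rho>. {w \<in> C. (v, w) \<in> parcs G}) = {w \<in> pverts G. (v, w) \<in> parcs G}"
    using Union_orbits by auto
  also have "card \<dots> = d" using assms(2) vG by (simp add: regular_def out_degree_eq_card)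
  finally show ?thesis .
qed

lemma connected_by_iff:
  assumes "B \<in> orbits G \<rho>" "C \<in> orbits G \<rho>"
  shows "connected_by G k B C \<longleftrightarrow> edge_weight B C = k"
proof -
  obtain u where "u \<in> B" using orbit_nonemptyE[OF assms(1)] .
  then show ?thesis using edge_weight[OF assms] by (auto simp: connected_by_def)
qed

lemma has_inner_degree_iff:
  "has_inner_degree G \<rho> d \<longleftrightarrow> (\<forall>B\<in>orbits G \<rho>. edge_weight B B = d)"
proof -
  have "(\<forall>v\<in>B. card {w \<in> B. (v, w) \<in> parcs G} = d) \<longleftrightarrow> edge_weight B B = d"
    if B: "B \<in> orbits G \<rho>" for B
    using connected_by_iff[OF B B] by (simp add: connected_by_def)
  then show ?thesis by (simp add: has_inner_degree_def out_degree_induced)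
qed

text \<open>
  If the orbits in \<open>Q\<close> already account for the full valency, no edge leaves their union.
\<close>
lemma closed_of_weights:
  assumes conn: "Digraph_Component.connected (with_proj G)" and reg: "regular G d"
    and Q: "Q \<subseteq> orbits G \<rho>" "Q \<noteq> {}" and full: "\<And>B. B \<in> Q \<Longrightarrow> (\<Sum>C\<in>Q. edge_weight B C) = d"
  shows "\<Union>Q = pverts G"
proof (rule connected_closed_set[OF conn])
  show "\<Union>Q \<subseteq> pverts G" using Q Union_orbits by auto
  show "\<Union>Q \<noteq> {}" using Q orbit_nonemptyE by (metis Union_empty_conv all_not_in_conv subsetD)
  fix x y assume x: "x \<in> \<Union>Q" and xy: "(x, y) \<in> parcs G"
  then obtain B where B: "B \<in> Q" "x \<in> B" by blast
  obtain C where C: "C \<in> orbits G \<rho>" "y \<in> C" using Union_orbits xy in_arcsD2 by blast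
  have fin: "finite (orbits G \<rho>)" using pair_finite_verts by (simp add: orbits_def)
  show "y \<in> \<Union>Q"
  proof (rule ccontr)
    assume "y \<notin> \<Union>Q"
    then have "C \<in> orbits G \<rho> - Q" using C by blast
    moreover have "(\<Sum>C\<in>orbits G \<rho> - Q. edge_weight B C) = 0"
      using full[OF B(1)] sum_edge_weight[of B d] reg B Q fin
      by (simp add: sum_diff_nat finite_subset subset_iff)
    ultimately have "edge_weight B C = 0" using fin by simp
    then have "card {w \<in> C. (x, w) \<in> parcs G} = 0" using edge_weight[OF _ C(1) B(2)] B(1) Q(1) by auto
    then have "{w \<in> C. (x, w) \<in> parcs G} = {}" using finite_orbit_set[OF C(1)] by simp
    then show False using C(2) xy by blast
  qed
qed

section \<open>Reflections that flip an edge\<close>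

lemma adj_shift: "(rot i x, rot j y) \<in> parcs G \<Longrightarrow> (rot (i + k) x, rot (j + k) y) \<in> parcs G"
  using rot_adj_iff[of k "rot i x" "rot j y"] by (simp add: add.commute)

text \<open>
  This is what makes reflections automorphisms: the difference of the two indices is kept while
  the two base points change places, and adjacency is symmetric.
\<close>
lemma adj_reflect:
  assumes "(rot i x, rot j y) \<in> parcs G"
  shows "(rot (c - i) y, rot (c - j) x) \<in> parcs G"
  using arcs_symmetric[OF adj_shift[OF assms, of "c - i - j"]] by simp

lemma edge_weight_posE:
  assumes "B \<in> orbits G \<rho>" "C \<in> orbits G \<rho>" "u \<in> B" "v \<in> C" "edge_weight B C > 0"
  obtains k where "(u, rot k v) \<in> parcs G"
proof -
  have "{w \<in> C. (u, w) \<in> parcs G} \<noteq> {}"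
    using edge_weight[OF assms(1-3)] assms(5) by (metis card.empty less_irrefl)
  then show thesis using that orbit_base(1)[OF assms(2,4)] by blast
qed

text \<open>
  The neighbours \<open>u\<^sub>k\<close> and \<open>u\<^bsub>-k\<^esub>\<close> of \<open>u\<close> come in pairs: if they coincided, then \<open>\<rho>\<^sup>k\<close> would interchange
  \<open>u\<close> and \<open>u\<^sub>k\<close>.
\<close>
lemma even_inner_weight:
  assumes hat: "half_arc_transitive G" and B: "B \<in> orbits G \<rho>"
  shows "even (edge_weight B B)"
proof -
  obtain u where u: "u \<in> B" using B by (rule orbit_nonemptyE)
  note uG = orbit_base(2)[OF B u]
  let ?S = "{w \<in> B. (u, w) \<in> parcs G}"
  let ?f = "reflect u u 0"
  have "even (card ?S)"
  proof (rule even_card_involution[where f = ?f])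
    show "finite ?S" using finite_orbit_set[OF B] by simp
    fix x assume x: "x \<in> ?S"
    then obtain k where k: "x = rot k u" using orbit_base(1)[OF B u] by blast
    have adj: "(u, rot k u) \<in> parcs G" using x k by simp
    have f: "?f x = rot (- k) u" "?f (rot (- k) u) = x"
      using reflect_rot[OF uG uG, of 0] k by simp_all
    have "(u, rot (- k) u) \<in> parcs G"
      using adj_reflect[of 0 u k u 0] adj arcs_symmetric adj_shift[of 0 u k u "- k"] by simp
    moreover have "rot (- k) u \<in> B" using rot_in_orbit_iff[OF B] u by simp
    moreover have "rot (- k) u \<noteq> rot k u"
    proof
      assume "rot (- k) u = rot k u"
      then have "rot k (rot k u) = u" by (metis rot_rot rot_0 add.right_inverse)
      then show False using half_arc_transitive_no_flip[OF hat rot_Aut adj] by blast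
    qed
    ultimately show "?f x \<in> ?S \<and> ?f (?f x) = x \<and> ?f x \<noteq> x" using f k by simp
  qed
  then show ?thesis using edge_weight[OF B B u] by simp
qed

text \<open>
  Here the graph is a Cayley graph of a cyclic group, and inversion followed by a translation
  flips an edge.
\<close>
lemma single_orbit_not_hat:
  assumes B: "B \<in> orbits G \<rho>" and V: "pverts G = B" and pos: "edge_weight B B > 0"
  shows "\<not> half_arc_transitive G"
proof
  assume hat: "half_arc_transitive G"
  obtain u where u: "u \<in> B" using B by (rule orbit_nonemptyE)
  note uG = orbit_base(2)[OF B u] and B_eq = orbit_base(1)[OF B u]
  obtain a where a: "(u, rot a u) \<in> parcs G" using edge_weight_posE[OF B B u u pos] .
  define h where "h = (\<lambda>x. if x \<in> B then reflect u u a x else x)"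
  have h: "h (rot i u) = rot (a - i) u" for i
    using B_eq by (simp add: h_def reflect_rot[OF uG uG])
  have "h \<in> Aut G"
  proof (rule involution_in_Aut)
    show "h x \<in> pverts G \<and> h (h x) = x" if "x \<in> pverts G" for x
      using that h uG unfolding V B_eq by auto
    show "h x = x" if "x \<notin> pverts G" for x using that by (simp add: h_def V)
    fix x y assume xy: "(x, y) \<in> parcs G"
    then obtain i j where "x = rot i u" "y = rot j u" using wellformed'[OF xy] V B_eq by auto
    then show "(h x, h y) \<in> parcs G" using xy adj_reflect[of i u j u a] h by simp
  qed
  then show False
    using half_arc_transitive_no_flip[OF hat _ a] h[of 0] h[of a] by simp
qed

text \<open>
  The reflection of the second orbit has to be chosen so that it maps the two-element cross
  connection set \<open>{s, t}\<close> to itself; the edge that is flipped lies inside the first orbit.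
\<close>
lemma two_orbits_inner_not_hat:
  assumes B: "B \<in> orbits G \<rho>" and C: "C \<in> orbits G \<rho>" and "B \<noteq> C" and V: "pverts G = B \<union> C"
    and pos: "edge_weight B B > 0" and two: "edge_weight B C = 2"
  shows "\<not> half_arc_transitive G"
proof
  assume hat: "half_arc_transitive G"
  obtain u where u: "u \<in> B" using B by (rule orbit_nonemptyE)
  obtain v where v: "v \<in> C" using C by (rule orbit_nonemptyE)
  note uG = orbit_base(2)[OF B u] and B_eq = orbit_base(1)[OF B u]
  note vG = orbit_base(2)[OF C v] and C_eq = orbit_base(1)[OF C v]
  have disj: "B \<inter> C = {}" using orbits_disjoint B C \<open>B \<noteq> C\<close> by blast
  obtain a where a: "(u, rot a u) \<in> parcs G" using edge_weight_posE[OF B B u u pos] .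
  have "card {w \<in> C. (u, w) \<in> parcs G} = 2" using edge_weight[OF B C u] two by simp
  then obtain p q where pq: "{w \<in> C. (u, w) \<in> parcs G} = {p, q}" by (auto simp: card_2_iff)
  then have "p \<in> C" "q \<in> C" by blast+
  then obtain s t where st: "p = rot s v" "q = rot t v" using C_eq by blast
  \<comment> \<open>With this constant an index difference \<open>k\<close> across the orbits becomes \<open>s + t - k\<close>.\<close>
  define c where "c = a + s + t"
  define h where "h = (\<lambda>x. if x \<in> B then reflect u u a x else if x \<in> C then reflect v v c x else x)"
  have in_B: "rot i u \<in> B" and in_C: "rot i v \<in> C" and not_B: "rot i v \<notin> B" for i
    using B_eq C_eq disj by auto
  have hu: "h (rot i u) = rot (a - i) u" for i
    using in_B by (simp add: h_def reflect_rot[OF uG uG])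
  have hv: "h (rot i v) = rot (c - i) v" for i
    using in_C not_B by (simp add: h_def reflect_rot[OF vG vG])
  have cross: "(h (rot i u), h (rot j v)) \<in> parcs G" if ij: "(rot i u, rot j v) \<in> parcs G" for i j
  proof -
    have "(u, rot (j - i) v) \<in> parcs G" using adj_shift[OF ij, of "- i"] by simp
    then have "rot (j - i) v \<in> {p, q}" using in_C pq by blast
    then have "rot (s + t - (j - i)) v \<in> {p, q}"
      using rot_eq_transfer[OF vG vG, of "j - i" s "s + t"]
        rot_eq_transfer[OF vG vG, of "j - i" t "s + t"] st by auto
    then have "(rot 0 u, rot (s + t - (j - i)) v) \<in> parcs G" using pq by auto
    from adj_shift[OF this, of "a - i"] show ?thesis by (simp add: hu hv c_def algebra_simps)
  qed
  have "h \<in> Aut G"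
  proof (rule involution_in_Aut)
    show "h x \<in> pverts G \<and> h (h x) = x" if "x \<in> pverts G" for x
    proof -
      have "x \<in> B \<or> x \<in> C" using that V by simp
      then show ?thesis using hu hv uG vG unfolding B_eq C_eq by auto
    qed
    show "h x = x" if "x \<notin> pverts G" for x using that by (simp add: h_def V)
    fix x y assume xy: "(x, y) \<in> parcs G"
    then have "x \<in> B \<union> C" "y \<in> B \<union> C" using wellformed'[OF xy] V by auto
    then consider i j where "x = rot i u" "y = rot j u" | i j where "x = rot i v" "y = rot j v"
      | i j where "x = rot i u" "y = rot j v" | i j where "x = rot j v" "y = rot i u"
      unfolding B_eq C_eq by blast
    then show "(h x, h y) \<in> parcs G"
    proof cases
      case (1 i j)
      then show ?thesis using xy adj_reflect[of i u j u a] hu by simp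
    next
      case (2 i j)
      then show ?thesis using xy adj_reflect[of i v j v c] hv by simp
    next
      case (3 i j)
      then show ?thesis using xy cross by simp
    next
      case (4 j i)
      then show ?thesis using arcs_symmetric cross arcs_symmetric[OF xy] by blast
    qed
  qed
  then show False
    using half_arc_transitive_no_flip[OF hat _ a] hu[of 0] hu[of a] by simp
qed

text \<open>
  Interchanging the two orbits by \<open>u\<^sub>i \<mapsto> v\<^bsub>s-i\<^esub>\<close> and \<open>v\<^sub>i \<mapsto> u\<^bsub>s-i\<^esub>\<close> keeps the index difference across an
  edge, so it works for every cross connection set; it is an automorphism because there are no
  inner edges, whose connection sets it would have to exchange.
\<close>
lemma two_orbits_bipartite_not_hat:
  assumes B: "B \<in> orbits G \<rho>" and C: "C \<in> orbits G \<rho>" and "B \<noteq> C" and V: "pverts G = B \<union> C"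
    and inner: "edge_weight B B = 0" "edge_weight C C = 0" and pos: "edge_weight B C > 0"
  shows "\<not> half_arc_transitive G"
proof
  assume hat: "half_arc_transitive G"
  obtain u where u: "u \<in> B" using B by (rule orbit_nonemptyE)
  obtain v where v: "v \<in> C" using C by (rule orbit_nonemptyE)
  note uG = orbit_base(2)[OF B u] and B_eq = orbit_base(1)[OF B u]
  note vG = orbit_base(2)[OF C v] and C_eq = orbit_base(1)[OF C v]
  have disj: "B \<inter> C = {}" using orbits_disjoint B C \<open>B \<noteq> C\<close> by blast
  obtain s where s: "(u, rot s v) \<in> parcs G" using edge_weight_posE[OF B C u v pos] .
  define h where "h = (\<lambda>x. if x \<in> B then reflect u v s x else if x \<in> C then reflect v u s x else x)"
  have in_B: "rot i u \<in> B" and in_C: "rot i v \<in> C" and not_B: "rot i v \<notin> B" for i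
    using B_eq C_eq disj by auto
  have hu: "h (rot i u) = rot (s - i) v" for i
    using in_B by (simp add: h_def reflect_rot[OF uG vG])
  have hv: "h (rot i v) = rot (s - i) u" for i
    using in_C not_B by (simp add: h_def reflect_rot[OF vG uG])
  have no_inner: "(x, y) \<notin> parcs G" if "x \<in> D" "y \<in> D" "D \<in> {B, C}" for x y D
  proof -
    have "D \<in> orbits G \<rho>" "edge_weight D D = 0" using that(3) B C inner by auto
    then show ?thesis using edge_weight[of D D x] finite_orbit_set[of D] that(1,2) by auto
  qed
  have "h \<in> Aut G"
  proof (rule involution_in_Aut)
    show "h x \<in> pverts G \<and> h (h x) = x" if "x \<in> pverts G" for x
    proof -
      have "x \<in> B \<or> x \<in> C" using that V by simp
      then show ?thesis using hu hv uG vG unfolding B_eq C_eq by auto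
    qed
    show "h x = x" if "x \<notin> pverts G" for x using that by (simp add: h_def V)
    fix x y assume xy: "(x, y) \<in> parcs G"
    then have "x \<in> B \<and> y \<in> C \<or> x \<in> C \<and> y \<in> B"
      using wellformed'[OF xy] V no_inner by blast
    then consider i j where "x = rot i u" "y = rot j v" | i j where "x = rot i v" "y = rot j u"
      unfolding B_eq C_eq by blast
    then show "(h x, h y) \<in> parcs G"
    proof cases
      case (1 i j)
      then show ?thesis using xy adj_reflect[of i u j v s] hu hv by simp
    next
      case (2 i j)
      then show ?thesis using xy adj_reflect[of i v j u s] hu hv by simp
    qed
  qed
  then show False
    using half_arc_transitive_no_flip[OF hat _ s] hu[of 0] hv[of s] by simp
qed

end

section \<open>Weights along the cycle of orbits\<close>

locale cyclic_orbit_graph = semiregular_graph +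
  fixes \<sigma> :: "'a \<Rightarrow> 'a"
  assumes sigma_Aut: "\<sigma> \<in> Aut G" and cyclic: "cyclic_on (image \<sigma>) (orbits G \<rho>)"
begin

definition shift :: "nat \<Rightarrow> 'a set \<Rightarrow> 'a set" where
  "shift k = image \<sigma> ^^ k"

lemma shift_in_orbits: "B \<in> orbits G \<rho> \<Longrightarrow> shift k B \<in> orbits G \<rho>"
  unfolding shift_def using cyclic by (rule cyclic_on_funpow_in)

lemma shift_shift: "shift i (shift k B) = shift (i + k) B"
  by (simp add: shift_def funpow_add)

lemma edge_weight_image:
  assumes "B \<in> orbits G \<rho>" "C \<in> orbits G \<rho>"
  shows "edge_weight (\<sigma> ` B) (\<sigma> ` C) = edge_weight B C"
proof -
  obtain v where v: "v \<in> B" using orbit_nonemptyE assms(1) .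
  have inj: "inj \<sigma>" using sigma_Aut by (auto simp: Aut_def intro: permutes_inj)
  have "\<sigma> ` B \<in> orbits G \<rho>" "\<sigma> ` C \<in> orbits G \<rho>" using cyclic_on_inI[OF cyclic] assms by auto
  then have "edge_weight (\<sigma> ` B) (\<sigma> ` C) = card {w \<in> \<sigma> ` C. (\<sigma> v, w) \<in> parcs G}"
    using edge_weight v by simp
  also have "{w \<in> \<sigma> ` C. (\<sigma> v, w) \<in> parcs G} = \<sigma> ` {w \<in> C. (v, w) \<in> parcs G}"
    using Aut_adj_iff[OF sigma_Aut] by auto
  also have "card \<dots> = card {w \<in> C. (v, w) \<in> parcs G}"
    by (rule card_image[OF inj_on_subset[OF inj subset_UNIV]])
  finally show ?thesis using edge_weight[OF assms v] by simp
qed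

lemma edge_weight_shift:
  assumes "B \<in> orbits G \<rho>" "C \<in> orbits G \<rho>"
  shows "edge_weight (shift k B) (shift k C) = edge_weight B C"
proof (induction k)
  case (Suc k)
  have "shift (Suc k) D = \<sigma> ` shift k D" for D by (simp add: shift_def)
  then show ?case using Suc edge_weight_image shift_in_orbits assms by simp
qed (simp add: shift_def)

lemma shift_enumerates:
  assumes "B \<in> orbits G \<rho>"
  shows "shift m B = B" "inj_on (\<lambda>k. shift k B) {..<m}"
    "orbits G \<rho> = (\<lambda>k. shift k B) ` {..<m}" "0 < m"
proof -
  have o: "orbits G \<rho> = orbit (image \<sigma>) B" using cyclic assms by (auto simp: cyclic_on_alldef)
  have "card (orbits G \<rho>) = m" using semi by (simp add: semiregular_def)
  from orbit_enumeration[of B "image \<sigma>" m, folded o, OF assms this]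
  show "shift m B = B" "inj_on (\<lambda>k. shift k B) {..<m}"
    "orbits G \<rho> = (\<lambda>k. shift k B) ` {..<m}" "0 < m" by (simp_all add: shift_def)
qed

text \<open>
  The weights depend only on the distance along the cycle of orbits: powers of \<open>\<sigma>\<close> commute, so the
  power that carries \<open>B\<close> to \<open>D\<close> also carries \<open>shift k B\<close> to \<open>shift k D\<close>.
\<close>
lemma edge_weight_shift_uniform:
  assumes "B \<in> orbits G \<rho>" "D \<in> orbits G \<rho>"
  shows "edge_weight D (shift k D) = edge_weight B (shift k B)"
proof -
  obtain i where i: "D = shift i B" using shift_enumerates(3)[OF assms(1)] assms(2) by blast
  have "shift k D = shift i (shift k B)" by (simp add: i shift_shift add.commute)
  then show ?thesis using i edge_weight_shift[of B "shift k B" i] shift_in_orbits assms by simp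
qed

lemma card_orbits_connected_by:
  assumes "B \<in> orbits G \<rho>" "D \<in> orbits G \<rho>"
  shows "card {C \<in> orbits G \<rho>. C \<noteq> D \<and> connected_by G j D C} =
    card {k. 0 < k \<and> k < m \<and> edge_weight B (shift k B) = j}"
proof -
  let ?K = "{k. 0 < k \<and> k < m \<and> edge_weight B (shift k B) = j}"
  note en = shift_enumerates[OF assms(2)]
  have D0: "shift 0 D = D" by (simp add: shift_def)
  have ne: "shift k D \<noteq> D \<longleftrightarrow> 0 < k" if "k < m" for k
    using inj_onD[OF en(2), of k 0] that en(4) D0 by auto
  have con: "connected_by G j D (shift k D) \<longleftrightarrow> edge_weight B (shift k B) = j" for k
    using connected_by_iff[OF assms(2) shift_in_orbits[OF assms(2)]]
      edge_weight_shift_uniform[OF assms] by simp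
  have "{C \<in> orbits G \<rho>. C \<noteq> D \<and> connected_by G j D C} = (\<lambda>k. shift k D) ` ?K"
  proof -
    have "{C \<in> orbits G \<rho>. C \<noteq> D \<and> connected_by G j D C} =
      (\<lambda>k. shift k D) ` {k \<in> {..<m}. shift k D \<noteq> D \<and> connected_by G j D (shift k D)}"
      by (subst en(3)) blast
    also have "{k \<in> {..<m}. shift k D \<noteq> D \<and> connected_by G j D (shift k D)} = ?K"
      using ne con by auto
    finally show ?thesis .
  qed
  also have "card \<dots> = card ?K"
    by (intro card_image inj_on_subset[OF en(2)]) auto
  finally show ?thesis .
qed

end

theorem mainTheorem3:
  fixes G :: "'a pair_pre_digraph"
  assumes "pair_graph G"
    and "Digraph_Component.connected (with_proj G)"
    and "quartic G"
    and "half_arc_transitive G"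
    and "weak_metacirculant G"
  shows "class_I G \<or> class_II G \<or> class_III G \<or> class_IV G"
proof -
  obtain m n \<rho> \<sigma> where rel: "weak_metacirculant_rel G m n \<rho> \<sigma>"
    using assms(5) by (auto simp: weak_metacirculant_def)
  interpret pair_graph G by fact
  interpret cyclic_orbit_graph G \<rho> m n \<sigma>
    by unfold_locales (use rel in \<open>auto simp: weak_metacirculant_rel_def\<close>)
  have reg: "regular G 4" using assms(3) by (simp add: quartic_def)
  obtain B where B: "B \<in> orbits G \<rho>" using cyclic by (auto simp: cyclic_on_def)
  define w where "w k = edge_weight B (shift k B)" for k
  define c where "c j = card {k. 0 < k \<and> k < m \<and> w k = j}" for j
  have shift_0: "shift 0 D = D" for D by (simp add: shift_def)
  note shift_B = shift_in_orbits[OF B] and enum = shift_enumerates[OF B]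
  have inner: "edge_weight D D = w 0" if "D \<in> orbits G \<rho>" for D
    using edge_weight_shift_uniform[OF B that, of 0] by (simp add: w_def shift_0)
  have inner_degree: "has_inner_degree G \<rho> d \<longleftrightarrow> w 0 = d" for d
    using inner B by (auto simp: has_inner_degree_iff)
  have counts: "card (single_edge_orbits G \<rho> D) = c 1" "card (double_edge_orbits G \<rho> D) = c 2"
    if "D \<in> orbits G \<rho>" for D
    using card_orbits_connected_by[OF B that]
    by (simp_all add: single_edge_orbits_def double_edge_orbits_def c_def w_def)
  have sym: "\<forall>k\<in>{0<..<m}. w (m - k) = w k"
  proof
    fix k assume "k \<in> {0<..<m}"
    then have k: "k < m" by simp
    have "w (m - k) = edge_weight (shift k B) (shift k (shift (m - k) B))"
      by (simp add: w_def edge_weight_shift B shift_B)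
    also have "shift k (shift (m - k) B) = B" using k enum(1) by (simp add: shift_shift)
    finally show "w (m - k) = w k" using edge_weight_sym[OF B shift_B] by (simp add: w_def)
  qed
  have even: "even (w 0)" using even_inner_weight[OF assms(4) B] inner[OF B] by simp
  have "(\<Sum>k<m. w k) = (\<Sum>C\<in>orbits G \<rho>. edge_weight B C)"
    unfolding w_def by (subst enum(3)) (simp add: sum.reindex[OF enum(2)])
  then have total: "(\<Sum>k<m. w k) = 4" using sum_edge_weight[OF B reg] by simp
  have two_orbits: "pverts G = B \<union> shift k B \<and> B \<noteq> shift k B"
    if "0 < k" "k < m" "w 0 + w k = 4" for k
  proof -
    have ne: "B \<noteq> shift k B" using inj_onD[OF enum(2), of k 0] that shift_0[of B] by auto
    have "\<Union>{B, shift k B} = pverts G"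
    proof (rule closed_of_weights[OF assms(2) reg])
      fix D assume "D \<in> {B, shift k B}"
      then show "(\<Sum>C\<in>{B, shift k B}. edge_weight D C) = 4"
        using ne that(3) inner[OF B] inner[OF shift_B] edge_weight_sym[OF B shift_B]
        by (auto simp: w_def)
    qed (use B shift_B in auto)
    then show ?thesis using ne by auto
  qed
  have "1 \<le> m" using enum(4) by simp
  from circulant_weight_cases[of m w, folded c_def, OF this sym even total] show ?thesis
  proof cases
    case 1
    then have "class_I G" unfolding class_I_def using rel inner_degree counts
      by (intro exI[of _ m] exI[of _ n] exI[of _ \<rho>] exI[of _ \<sigma>]) simp
    then show ?thesis by blast
  next
    case 2
    then have "class_II G" unfolding class_II_def using rel inner_degree counts
      by (intro exI[of _ m] exI[of _ n] exI[of _ \<rho>] exI[of _ \<sigma>]) simp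
    then show ?thesis by blast
  next
    case 3
    then have "class_III G" unfolding class_III_def using rel inner_degree counts
      by (intro exI[of _ m] exI[of _ n] exI[of _ \<rho>] exI[of _ \<sigma>]) simp
    then show ?thesis by blast
  next
    case 4
    then have "class_IV G" unfolding class_IV_def using rel inner_degree counts
      by (intro exI[of _ m] exI[of _ n] exI[of _ \<rho>] exI[of _ \<sigma>]) simp
    then show ?thesis by blast
  next
    case 5
    have "\<Union>{B} = pverts G"
      by (rule closed_of_weights[OF assms(2) reg]) (use B inner 5 in auto)
    then show ?thesis using single_orbit_not_hat[OF B] inner[OF B] 5 assms(4) by simp
  next
    case (6 k)
    then show ?thesis
      using two_orbits_inner_not_hat[OF B shift_B[of k]] two_orbits[of k] inner[OF B] assms(4)
      by (simp add: w_def)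
  next
    case (7 k)
    then show ?thesis
      using two_orbits_bipartite_not_hat[OF B shift_B[of k]] two_orbits[of k] inner[OF B]
        inner[OF shift_B[of k]] assms(4)
      by (simp add: w_def)
  qed
qed

end
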